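(* Let $K$ be a perfect field, $f$ an irreducible polynomial over $K$ with set of roots $R\subset\bar K$, and let $B=\{\beta_1,\beta_2,\dots,\beta_m\}\subset R$ be a set of $m$ distinct roots. (1) $B$ is a minimal generating set of the splitting field of $f$ over $K$ if and only if for every permutation $(i_1,i_2,\dots,i_m)$ of $(1,2,\dots,m)$, the chain $$K\subseteq K(\beta_{i_1})\subseteq K(\beta_{i_1},\beta_{i_2})\subseteq\dots\subseteq K(\beta_{i_1},\beta_{i_2},\dots,\beta_{i_m})$$ is a cluster tower for $f$ of length $m$. In this case any such cluster tower is called a minimal cluster tower. (2) If $B$ is a minimal generating set of the splitting field of $f$ over $K$, then the $m!$ minimal cluster towers obtained from the $m!$ permutations in (1) are pairwise distinct; in other words, $B$ has $m!$ minimal cluster towers associated with it. (3) $B$ is a shortest minimal generating set of the splitting field of $f$ over $K$ if and only if $$K\subseteq K(\beta_1)\subseteq K(\beta_1,\beta_2)\subseteq\dots\subseteq K(\beta_1,\beta_2,\dots,\beta_m)$$ is a cluster tower for $f$ of length $m$ and $m$ is the least possible length of any cluster tower for $f$.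
   Context: $\bar K$ is a fixed algebraic closure of $K$, $K_f\subset\bar K$ is the splitting field of $f$, and $K(B)$ is the field generated over $K$ by $B$. Minimal generating set: $B\subset R$ is a minimal generating set of the splitting field of $f$ over $K$ if $K(B)=K_f$ and $K(A)\neq K_f$ for every $A\subsetneq B$. It is a shortest minimal generating set if it is a minimal generating set of least possible cardinality. Clusters: roots $\alpha,\beta\in R$ are equivalent if $K(\alpha)=K(\beta)$ (equality of subfields of $\bar K$); the equivalence classes are the root clusters of $f$, and $s_K(f)$ is their number. Cluster towers: for an ordering $(\beta_1,\dots,\beta_s)$, $s=s_K(f)$, of a complete set of representatives of the clusters, the chain $K\subseteq K(\beta_1)\subseteq K(\beta_1,\beta_2)\subseteq\dots\subseteq K(\beta_1,\dots,\beta_s)=K_f$ is a cluster tower of $f$. More generally, a chain $K\subseteq K(\gamma_1)\subseteq K(\gamma_1,\gamma_2)\subseteq\dots\subseteq K(\gamma_1,\dots,\gamma_m)$ with $\gamma_1,\dots,\gamma_m$ distinct roots of $f$ is regarded as a cluster tower for $f$ exactly when it terminates at the splitting field, i.e. $K(\gamma_1,\dots,\gamma_m)=K_f$. The length of a cluster tower is the number of strict inclusions in it. Two minimal cluster towers are equal if their fields are equal at each step, and distinct otherwise. *)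

theory Defs
  imports "HOL-Algebra.Algebraic_Closure" "HOL-Algebra.Generated_Fields" "HOL-Combinatorics.Permutations"
begin

text \<open>
  Throughout, \<^term>\<open>L\<close> is an algebraic closure of its subfield \<^term>\<open>K\<close>
  (\<^term>\<open>algebraic_closure L K\<close>), and \<^term>\<open>f\<close> is an element of the carrier of the polynomial
  ring \<^term>\<open>univ_poly L K\<close>, i.e. the list of its coefficients.
\<close>

text \<open>Every irreducible polynomial over \<^term>\<open>K\<close> has only simple roots in the algebraic closure.\<close>

definition perfect_subfield :: "('a, 'b) ring_scheme \<Rightarrow> 'a set \<Rightarrow> bool" where
  "perfect_subfield L K \<longleftrightarrow>
     subfield K L \<and>
     (\<forall>p \<in> carrier (univ_poly L K). pirreducible\<^bsub>L\<^esub> K p \<longrightarrow> (\<forall>x. ring.alg_mult L p x \<le> 1))"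

definition root_set :: "('a, 'b) ring_scheme \<Rightarrow> 'a list \<Rightarrow> 'a set" where
  "root_set L f = {x. ring.is_root L f x}"

definition adjoin :: "('a, 'b) ring_scheme \<Rightarrow> 'a set \<Rightarrow> 'a set \<Rightarrow> 'a set" where
  "adjoin L K A = generate_field L (K \<union> A)"

definition splitting_field :: "('a, 'b) ring_scheme \<Rightarrow> 'a set \<Rightarrow> 'a list \<Rightarrow> 'a set" where
  "splitting_field L K f = adjoin L K (root_set L f)"

definition minimal_generating_set ::
    "('a, 'b) ring_scheme \<Rightarrow> 'a set \<Rightarrow> 'a list \<Rightarrow> 'a set \<Rightarrow> bool" where
  "minimal_generating_set L K f B \<longleftrightarrow>
     B \<subseteq> root_set L f \<and> adjoin L K B = splitting_field L K f \<and>
     (\<forall>A. A \<subset> B \<longrightarrow> adjoin L K A \<noteq> splitting_field L K f)"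

definition shortest_minimal_generating_set ::
    "('a, 'b) ring_scheme \<Rightarrow> 'a set \<Rightarrow> 'a list \<Rightarrow> 'a set \<Rightarrow> bool" where
  "shortest_minimal_generating_set L K f B \<longleftrightarrow>
     minimal_generating_set L K f B \<and>
     (\<forall>A. minimal_generating_set L K f A \<longrightarrow> card B \<le> card A)"

text \<open>
  A chain of fields is the list of its members, starting with \<^term>\<open>K\<close> itself, so that equality of
  chains is equality of the fields at each step. The sequence of roots is
  \<open>\<gamma> 1, \<dots>, \<gamma> n\<close>; values of \<^term>\<open>\<gamma>\<close> outside \<open>{1..n}\<close> are irrelevant.
\<close>

definition adjunction_chain ::
    "('a, 'b) ring_scheme \<Rightarrow> 'a set \<Rightarrow> (nat \<Rightarrow> 'a) \<Rightarrow> nat \<Rightarrow> 'a set list" where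
  "adjunction_chain L K \<gamma> n = map (\<lambda>j. adjoin L K (\<gamma> ` {1..j})) [0..<Suc n]"

definition cluster_tower ::
    "('a, 'b) ring_scheme \<Rightarrow> 'a set \<Rightarrow> 'a list \<Rightarrow> 'a set list \<Rightarrow> bool" where
  "cluster_tower L K f Fs \<longleftrightarrow>
     (\<exists>\<gamma> n. inj_on \<gamma> {1..n} \<and> \<gamma> ` {1..n} \<subseteq> root_set L f \<and>
            Fs = adjunction_chain L K \<gamma> n \<and> last Fs = splitting_field L K f)"

definition tower_length :: "'a set list \<Rightarrow> nat" where
  "tower_length Fs = card {j. Suc j < length Fs \<and> Fs ! j \<subset> Fs ! Suc j}"

definition minimal_cluster_towers ::
    "('a, 'b) ring_scheme \<Rightarrow> 'a set \<Rightarrow> 'a list \<Rightarrow> 'a set \<Rightarrow> 'a set list set" where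
  "minimal_cluster_towers L K f B =
     {adjunction_chain L K \<gamma> (card B) | \<gamma>.
        minimal_generating_set L K f B \<and> bij_betw \<gamma> {1..card B} B}"

text \<open>
  The root clusters, and the fact that an ordering of a complete set of representatives of them
  gives a cluster tower in the sense of \<^const>\<open>cluster_tower\<close>, which allows arbitrary
  sequences of distinct roots generating the splitting field.
\<close>

definition root_clusters :: "('a, 'b) ring_scheme \<Rightarrow> 'a set \<Rightarrow> 'a list \<Rightarrow> 'a set set" where
  "root_clusters L K f =
     root_set L f // {(\<alpha>, \<beta>). \<alpha> \<in> root_set L f \<and> \<beta> \<in> root_set L f \<and> adjoin L K {\<alpha>} = adjoin L K {\<beta>}}"

lemma adjunction_chain_0: "algebraic_closure L K \<Longrightarrow> adjunction_chain L K \<gamma> n ! 0 = K"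
proof -
  assume *: "algebraic_closure L K"
  then interpret algebraic_closure L K .
  have "subfield K L" by (rule subfield_axioms)
  then have "generate_field L K = K"
    by (intro equalityI generate_field_min_subfield1 subsetI generate_field.incl)
      (auto dest: subfieldE(3))
  then show ?thesis
    by (simp add: adjunction_chain_def adjoin_def nth_append del: upt_Suc)
qed

lemma cluster_tower_of_representatives:
  assumes "algebraic_closure L K" and "f \<in> carrier (univ_poly L K)"
    and \<gamma>: "\<gamma> ` {1..s} \<subseteq> root_set L f" and s: "s = card (root_clusters L K f)"
    and repr: "\<forall>C \<in> root_clusters L K f. \<exists>!i. i \<in> {1..s} \<and> \<gamma> i \<in> C"
  shows "cluster_tower L K f (adjunction_chain L K \<gamma> s)"
proof -
  interpret algebraic_closure L K by fact
  let ?R = "root_set L f"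
  let ?r = "{(\<alpha>, \<beta>). \<alpha> \<in> ?R \<and> \<beta> \<in> ?R \<and> adjoin L K {\<alpha>} = adjoin L K {\<beta>}}"
  have equiv: "equiv ?R ?r"
    by (auto simp: equiv_def refl_on_def sym_def trans_def)
  have R: "?R \<subseteq> carrier L" by (auto simp: root_set_def is_root_def)
  have K: "K \<subseteq> carrier L" using subfieldE(3)[OF subfield_axioms] .
  have in_cluster: "?r `` {x} \<in> root_clusters L K f \<and> x \<in> ?r `` {x}" if "x \<in> ?R" for x
    using that by (auto simp: root_clusters_def quotient_def)
  have inj: "inj_on \<gamma> {1..s}"
  proof (rule inj_onI)
    fix i j assume ij: "i \<in> {1..s}" "j \<in> {1..s}" "\<gamma> i = \<gamma> j"
    then have "\<gamma> i \<in> ?R" using \<gamma> by auto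
    then have C: "?r `` {\<gamma> i} \<in> root_clusters L K f" "\<gamma> i \<in> ?r `` {\<gamma> i}"
      using in_cluster by blast+
    with ij(3) have "\<gamma> j \<in> ?r `` {\<gamma> i}" by metis
    with C ij(1,2) bspec[OF repr C(1)] show "i = j" by blast
  qed
  have "x \<in> adjoin L K (\<gamma> ` {1..s})" if x: "x \<in> ?R" for x
  proof -
    obtain i where i: "i \<in> {1..s}" "\<gamma> i \<in> ?r `` {x}"
      using bspec[OF repr conjunct1[OF in_cluster[OF x]]] by blast
    then have "adjoin L K {x} = adjoin L K {\<gamma> i}" by auto
    moreover have "x \<in> adjoin L K {x}" by (auto simp: adjoin_def intro: generate_field.incl)
    moreover have "adjoin L K {\<gamma> i} \<subseteq> adjoin L K (\<gamma> ` {1..s})"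
      unfolding adjoin_def using i(1) \<gamma> R K by (intro mono_generate_field) auto
    ultimately show ?thesis by auto
  qed
  then have sub: "K \<union> ?R \<subseteq> adjoin L K (\<gamma> ` {1..s})"
    by (auto simp: adjoin_def intro: generate_field.incl)
  have "splitting_field L K f \<subseteq> adjoin L K (\<gamma> ` {1..s})"
    unfolding splitting_field_def adjoin_def[of L K ?R]
    by (rule generate_field_min_subfield1)
      (use sub R K \<gamma> in \<open>auto simp: adjoin_def intro!: generate_field_is_subfield\<close>)
  moreover have "adjoin L K (\<gamma> ` {1..s}) \<subseteq> splitting_field L K f"
    unfolding splitting_field_def adjoin_def using \<gamma> R K by (intro mono_generate_field) auto
  ultimately have "last (adjunction_chain L K \<gamma> s) = splitting_field L K f"
    by (simp add: adjunction_chain_def)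
  with inj \<gamma> show ?thesis unfolding cluster_tower_def by blast
qed

end

theory Submission
  imports Defs
begin

text \<open>
  Only the fact that \<^const>\<open>adjoin\<close> is a closure operator matters. Call a step of a chain
  \<^emph>\<open>new\<close> if the adjoined root is not yet in the field; the length of the chain is the number of
  new steps. If \<open>B\<close> is a minimal generating set, the only members of \<open>B\<close> in the field generated by
  a subset \<open>A\<close> of \<open>B\<close> are those of \<open>A\<close>, so all steps of a chain through \<open>B\<close> are new, and the sets
  \<open>{\<beta> 1, \<dots>, \<beta> j}\<close> can be read off the fields. Conversely, the roots adjoined in the new steps of
  any cluster tower generate the splitting field, so some subset of them is a minimal
  generating set.
\<close>

context algebraic_closure
begin

section \<open>Adjunction as a closure operator\<close>

lemma K_in_carrier: "K \<subseteq> carrier L"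
  using subfieldE(3)[OF subfield_axioms] .

lemma root_set_in_carrier: "root_set L f \<subseteq> carrier L"
  by (auto simp: root_set_def is_root_def)

lemma finite_root_set: "f \<in> carrier (K[X]) \<Longrightarrow> finite (root_set L f)"
  unfolding root_set_def
  by (intro finite_number_of_roots carrier_polynomial_shell[OF subfieldE(1)[OF subfield_axioms]])

lemma adjoin_incl: "A \<subseteq> adjoin L K A"
  by (auto simp: adjoin_def intro: generate_field.incl)

text \<open>With \<open>adjoin_incl\<close> and \<open>adjoin_mono\<close> these are the closure
  laws; \<open>generate_field\<close> is not unfolded again after this proof.\<close>

lemma adjoin_least:
  assumes "S \<subseteq> carrier L" "A \<subseteq> adjoin L K S"
  shows "adjoin L K A \<subseteq> adjoin L K S"
proof -
  have KS: "K \<union> S \<subseteq> carrier L" using K_in_carrier assms(1) by blast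
  have F: "subfield (adjoin L K S) L" unfolding adjoin_def by (rule generate_field_is_subfield[OF KS])
  moreover have "K \<union> A \<subseteq> adjoin L K S" using assms(2) by (auto simp: adjoin_def intro: generate_field.incl)
  moreover from this have "K \<union> A \<subseteq> carrier L"
    using subfieldE(3)[OF F] by (rule subset_trans)
  ultimately show ?thesis
    unfolding adjoin_def[of L K A] by (rule generate_field_min_subfield1[rotated])
qed

lemma adjoin_mono: "S \<subseteq> carrier L \<Longrightarrow> A \<subseteq> S \<Longrightarrow> adjoin L K A \<subseteq> adjoin L K S"
  using adjoin_least adjoin_incl by blast

text \<open>The tool for shrinking a generating set: it serves to drop a redundant root, and to keep
  only the roots adjoined in new steps of a chain.\<close>

lemma adjoin_eq_splitting_fieldI:
  assumes "A \<subseteq> root_set L f" "B \<subseteq> adjoin L K A" "adjoin L K B = splitting_field L K f"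
  shows "adjoin L K A = splitting_field L K f"
proof
  show "adjoin L K A \<subseteq> splitting_field L K f"
    unfolding splitting_field_def using assms(1) root_set_in_carrier by (intro adjoin_mono)
  show "splitting_field L K f \<subseteq> adjoin L K A"
    using adjoin_least[of A B] assms root_set_in_carrier by blast
qed

section \<open>Minimal generating sets as independent sets\<close>

text \<open>Testing single deletions suffices: a proper subset omits some \<open>b\<close>, and if
  it generated the splitting field, monotonicity would put \<open>b\<close> into the field of
  \<open>B - {b}\<close>.\<close>

lemma minimal_generating_setI:
  assumes "B \<subseteq> root_set L f" "adjoin L K B = splitting_field L K f"
    and "\<And>b. b \<in> B \<Longrightarrow> b \<notin> adjoin L K (B - {b})"
  shows "minimal_generating_set L K f B"
  unfolding minimal_generating_set_def
proof (intro conjI allI impI notI assms(1,2))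
  fix A assume A: "A \<subset> B" "adjoin L K A = splitting_field L K f"
  then obtain b where b: "b \<in> B" "b \<notin> A" by blast
  have "b \<in> adjoin L K A" using A(2) assms(2) adjoin_incl b by blast
  also have "\<dots> \<subseteq> adjoin L K (B - {b})"
    using A(1) b assms(1) root_set_in_carrier by (intro adjoin_mono) auto
  finally show False using assms(3) b(1) by blast
qed

text \<open>A member \<open>b\<close> of the field of \<open>A\<close> with \<open>b\<close> in
  \<open>B\<close> but not in \<open>A\<close> would lie in the field of \<open>B - {b}\<close>, so
  \<open>B - {b}\<close> would still generate. Hence a subset of \<open>B\<close> can be recovered
  from its field.\<close>

lemma adjoin_Int_minimal_generating_set:
  assumes "minimal_generating_set L K f B" "A \<subseteq> B"
  shows "adjoin L K A \<inter> B = A"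
proof
  have B: "B \<subseteq> root_set L f" "adjoin L K B = splitting_field L K f"
    and min: "\<And>A. A \<subset> B \<Longrightarrow> adjoin L K A \<noteq> splitting_field L K f"
    using assms(1) unfolding minimal_generating_set_def by blast+
  show "adjoin L K A \<inter> B \<subseteq> A"
  proof (intro subsetI, rule ccontr)
    fix b assume b: "b \<in> adjoin L K A \<inter> B" "b \<notin> A"
    have "adjoin L K A \<subseteq> adjoin L K (B - {b})"
      using b(2) assms(2) B(1) root_set_in_carrier by (intro adjoin_mono) auto
    then have "B \<subseteq> adjoin L K (B - {b})" using adjoin_incl[of "B - {b}"] b(1) by blast
    then have "adjoin L K (B - {b}) = splitting_field L K f"
      using adjoin_eq_splitting_fieldI[of "B - {b}" f B] B by blast
    moreover have "B - {b} \<subset> B" using b(1) by blast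
    ultimately show False using min by metis
  qed
  show "A \<subseteq> adjoin L K A \<inter> B" using adjoin_incl assms(2) by blast
qed

text \<open>The finite family of generating subsets of \<open>A\<close> has an inclusion-minimal
  member.\<close>

lemma exists_minimal_generating_subset:
  assumes "finite A" "A \<subseteq> root_set L f" "adjoin L K A = splitting_field L K f"
  obtains B where "B \<subseteq> A" "minimal_generating_set L K f B"
proof -
  define G where "G = {B. B \<subseteq> A \<and> adjoin L K B = splitting_field L K f}"
  have "finite G" "A \<in> G" using assms by (auto simp: G_def)
  then obtain B where BG: "B \<in> G" and min: "\<And>C. C \<in> G \<Longrightarrow> C \<subseteq> B \<Longrightarrow> B = C"
    using finite_has_minimal2[of G A] by blast
  from BG have B: "B \<subseteq> A" "adjoin L K B = splitting_field L K f" by (auto simp: G_def)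
  have "adjoin L K C \<noteq> splitting_field L K f" if "C \<subset> B" for C
  proof
    assume "adjoin L K C = splitting_field L K f"
    with that B(1) have "C \<in> G" by (simp add: G_def less_imp_le)
    from min[OF this] that show False by blast
  qed
  with B assms(2) have "minimal_generating_set L K f B"
    unfolding minimal_generating_set_def by blast
  with B(1) that show ?thesis by blast
qed

section \<open>Chains and their lengths\<close>

lemma length_adjunction_chain: "length (adjunction_chain L K \<gamma> n) = Suc n"
  by (simp add: adjunction_chain_def)

lemma nth_adjunction_chain:
  "j \<le> n \<Longrightarrow> adjunction_chain L K \<gamma> n ! j = adjoin L K (\<gamma> ` {1..j})"
  unfolding adjunction_chain_def by (subst nth_map) (auto simp del: upt_Suc)

lemma last_adjunction_chain: "last (adjunction_chain L K \<gamma> n) = adjoin L K (\<gamma> ` {1..n})"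
  by (simp add: adjunction_chain_def)

lemma cluster_tower_adjunction_chainI:
  assumes "inj_on \<gamma> {1..n}" "\<gamma> ` {1..n} \<subseteq> root_set L f"
    and "adjoin L K (\<gamma> ` {1..n}) = splitting_field L K f"
  shows "cluster_tower L K f (adjunction_chain L K \<gamma> n)"
  using assms last_adjunction_chain unfolding cluster_tower_def by blast

lemma adjoin_psubset_iff:
  assumes "\<gamma> ` {1..Suc j} \<subseteq> carrier L"
  shows "adjoin L K (\<gamma> ` {1..j}) \<subset> adjoin L K (\<gamma> ` {1..Suc j})
    \<longleftrightarrow> \<gamma> (Suc j) \<notin> adjoin L K (\<gamma> ` {1..j})"
proof -
  have ins: "\<gamma> ` {1..Suc j} = insert (\<gamma> (Suc j)) (\<gamma> ` {1..j})"
    by (simp add: atLeastAtMostSuc_conv)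
  have "adjoin L K (\<gamma> ` {1..j}) \<subseteq> adjoin L K (\<gamma> ` {1..Suc j})"
    using assms by (intro adjoin_mono) auto
  moreover have "adjoin L K (\<gamma> ` {1..Suc j}) \<subseteq> adjoin L K (\<gamma> ` {1..j})"
    if "\<gamma> (Suc j) \<in> adjoin L K (\<gamma> ` {1..j})"
    using assms that adjoin_incl[of "\<gamma> ` {1..j}"] unfolding ins by (intro adjoin_least) auto
  moreover have "\<gamma> (Suc j) \<in> adjoin L K (\<gamma> ` {1..Suc j})"
    using adjoin_incl[of "\<gamma> ` {1..Suc j}"] by auto
  ultimately show ?thesis by blast
qed

text \<open>Replaces strict inclusions by new roots. Steps are counted from \<open>0\<close>: index
  \<open>j\<close> is the step that adjoins \<open>\<gamma> (Suc j)\<close>.\<close>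

lemma tower_length_adjunction_chain:
  assumes "\<gamma> ` {1..n} \<subseteq> carrier L"
  shows "tower_length (adjunction_chain L K \<gamma> n)
    = card {j. j < n \<and> \<gamma> (Suc j) \<notin> adjoin L K (\<gamma> ` {1..j})}"
proof -
  have "adjunction_chain L K \<gamma> n ! j \<subset> adjunction_chain L K \<gamma> n ! Suc j
      \<longleftrightarrow> \<gamma> (Suc j) \<notin> adjoin L K (\<gamma> ` {1..j})" if "j < n" for j
  proof -
    have "\<gamma> ` {1..Suc j} \<subseteq> carrier L" using that assms by fastforce
    then show ?thesis using that by (simp only: nth_adjunction_chain adjoin_psubset_iff Suc_leI less_imp_le)
  qed
  then show ?thesis
    unfolding tower_length_def length_adjunction_chain by (intro arg_cong[of _ _ card]) auto
qed

text \<open>The new steps form a subset of \<open>{..<n}\<close>, which has \<open>n\<close>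
  elements only if it is everything.\<close>

lemma tower_length_eq_iff:
  assumes "\<gamma> ` {1..n} \<subseteq> carrier L"
  shows "tower_length (adjunction_chain L K \<gamma> n) = n
    \<longleftrightarrow> (\<forall>j<n. \<gamma> (Suc j) \<notin> adjoin L K (\<gamma> ` {1..j}))"
proof
  assume "tower_length (adjunction_chain L K \<gamma> n) = n"
  then have "card {j. j < n \<and> \<gamma> (Suc j) \<notin> adjoin L K (\<gamma> ` {1..j})} = card {..<n}"
    using tower_length_adjunction_chain[OF assms] by simp
  then have "{j. j < n \<and> \<gamma> (Suc j) \<notin> adjoin L K (\<gamma> ` {1..j})} = {..<n}"
    by (intro card_subset_eq) auto
  then show "\<forall>j<n. \<gamma> (Suc j) \<notin> adjoin L K (\<gamma> ` {1..j})" by blast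
next
  assume "\<forall>j<n. \<gamma> (Suc j) \<notin> adjoin L K (\<gamma> ` {1..j})"
  then have "{j. j < n \<and> \<gamma> (Suc j) \<notin> adjoin L K (\<gamma> ` {1..j})} = {..<n}" by auto
  then show "tower_length (adjunction_chain L K \<gamma> n) = n"
    using tower_length_adjunction_chain[OF assms] by simp
qed

lemma inj_on_Suc_notin_image: "inj_on \<gamma> {1..m} \<Longrightarrow> k < m \<Longrightarrow> \<gamma> (Suc k) \<notin> \<gamma> ` {1..k}"
  by (subst inj_on_image_mem_iff[of \<gamma> "{1..m}"]) auto

section \<open>Towers through a minimal generating set\<close>

text \<open>Independence makes every step new, whatever the order. Stated for an arbitrary
  enumeration so as to cover all reorderings of \<open>B\<close> and also competing minimal
  generating sets.\<close>

lemma minimal_generating_set_tower: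
  assumes B: "minimal_generating_set L K f B" and \<gamma>: "bij_betw \<gamma> {1..m} B"
  shows "cluster_tower L K f (adjunction_chain L K \<gamma> m)"
    and "tower_length (adjunction_chain L K \<gamma> m) = m"
proof -
  have inj: "inj_on \<gamma> {1..m}" and im: "\<gamma> ` {1..m} = B" using \<gamma> by (auto simp: bij_betw_def)
  have R: "B \<subseteq> root_set L f" and gen: "adjoin L K B = splitting_field L K f"
    using B by (auto simp: minimal_generating_set_def)
  show "cluster_tower L K f (adjunction_chain L K \<gamma> m)"
    using inj R gen unfolding im[symmetric] by (rule cluster_tower_adjunction_chainI)
  have new: "\<gamma> (Suc j) \<notin> adjoin L K (\<gamma> ` {1..j})" if j: "j < m" for j
  proof
    assume "\<gamma> (Suc j) \<in> adjoin L K (\<gamma> ` {1..j})"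
    moreover have "\<gamma> (Suc j) \<in> B" "\<gamma> ` {1..j} \<subseteq> B" unfolding im[symmetric] using j by auto
    ultimately have "\<gamma> (Suc j) \<in> \<gamma> ` {1..j}"
      using adjoin_Int_minimal_generating_set[OF B, of "\<gamma> ` {1..j}"] by blast
    with inj_on_Suc_notin_image[OF inj j] show False by contradiction
  qed
  have "\<gamma> ` {1..m} \<subseteq> carrier L" unfolding im using R root_set_in_carrier by (rule subset_trans)
  then show "tower_length (adjunction_chain L K \<gamma> m) = m"
    by (rule tower_length_eq_iff[THEN iffD2]) (intro allI impI new)
qed

text \<open>Intersecting the fields with \<open>B\<close> recovers the sets of the first
  \<open>j\<close> roots; two consecutive sets differ by exactly one root, which is therefore
  determined.\<close>

lemma adjunction_chain_inj:
  assumes B: "minimal_generating_set L K f B"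
    and \<gamma>: "bij_betw \<gamma> {1..m} B" and \<delta>: "bij_betw \<delta> {1..m} B"
    and eq: "adjunction_chain L K \<gamma> m = adjunction_chain L K \<delta> m" and i: "i \<in> {1..m}"
  shows "\<gamma> i = \<delta> i"
proof -
  have *: "\<gamma> ` {1..j} = \<delta> ` {1..j}" if "j \<le> m" for j
  proof -
    have Int: "adjoin L K (g ` {1..j}) \<inter> B = g ` {1..j}" if "bij_betw g {1..m} B" for g
    proof (rule adjoin_Int_minimal_generating_set[OF B])
      show "g ` {1..j} \<subseteq> B"
        unfolding bij_betw_imp_surj_on[OF that, symmetric] using \<open>j \<le> m\<close> by (intro image_mono) auto
    qed
    have "adjoin L K (\<gamma> ` {1..j}) = adjoin L K (\<delta> ` {1..j})"
      using nth_adjunction_chain[OF that, of \<gamma>] nth_adjunction_chain[OF that, of \<delta>] eq by simp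
    then show ?thesis using Int[OF \<gamma>] Int[OF \<delta>] by metis
  qed
  obtain k where k: "i = Suc k" using i by (cases i) auto
  have "\<gamma> i \<notin> \<gamma> ` {1..k}"
    using i k inj_on_Suc_notin_image[OF bij_betw_imp_inj_on[OF \<gamma>]] by simp
  \<comment> \<open>The first \<open>i\<close> roots agree as sets, and so do the first
    \<open>k\<close>; since \<open>\<gamma> i\<close> is not among the latter, only
    \<open>\<delta> i\<close> remains.\<close>
  moreover have "\<gamma> i \<in> insert (\<delta> i) (\<delta> ` {1..k})"
  proof -
    have "\<gamma> i \<in> \<gamma> ` {1..i}" using i by simp
    also have "\<dots> = \<delta> ` {1..i}" using *[of i] i by simp
    also have "\<dots> = insert (\<delta> i) (\<delta> ` {1..k})" by (simp add: k atLeastAtMostSuc_conv)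
    finally show ?thesis .
  qed
  moreover have "\<gamma> ` {1..k} = \<delta> ` {1..k}" using *[of k] i k by simp
  ultimately show ?thesis by blast
qed

lemma adjunction_chain_cong:
  "(\<And>i. i \<in> {1..n} \<Longrightarrow> \<gamma> i = \<delta> i) \<Longrightarrow> adjunction_chain L K \<gamma> n = adjunction_chain L K \<delta> n"
proof (rule nth_equalityI)
  fix j
  assume eq: "\<And>i. i \<in> {1..n} \<Longrightarrow> \<gamma> i = \<delta> i"
    and j: "j < length (adjunction_chain L K \<gamma> n)"
  then have "\<gamma> ` {1..j} = \<delta> ` {1..j}"
    by (intro image_cong) (auto simp: length_adjunction_chain)
  with j show "adjunction_chain L K \<gamma> n ! j = adjunction_chain L K \<delta> n ! j"
    by (simp add: length_adjunction_chain nth_adjunction_chain)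
qed (simp add: length_adjunction_chain)

text \<open>Every enumeration of \<open>B\<close> is \<open>\<beta>\<close> after a permutation of
  the indices, so counting towers becomes counting permutations.\<close>

lemma minimal_cluster_towers_eq:
  assumes "minimal_generating_set L K f B" and \<beta>: "bij_betw \<beta> {1..m} B"
  shows "minimal_cluster_towers L K f B
    = (\<lambda>\<sigma>. adjunction_chain L K (\<beta> \<circ> \<sigma>) m) ` {\<sigma>. \<sigma> permutes {1..m}}"
proof
  have m: "card B = m" using bij_betw_same_card[OF \<beta>] by simp
  show "minimal_cluster_towers L K f B
    \<subseteq> (\<lambda>\<sigma>. adjunction_chain L K (\<beta> \<circ> \<sigma>) m) ` {\<sigma>. \<sigma> permutes {1..m}}"
  proof
    fix Fs assume "Fs \<in> minimal_cluster_towers L K f B"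
    then obtain \<gamma> where Fs: "Fs = adjunction_chain L K \<gamma> m" and \<gamma>: "bij_betw \<gamma> {1..m} B"
      unfolding minimal_cluster_towers_def m by blast
    \<comment> \<open>This is the inverse of \<open>\<beta>\<close> after \<open>\<gamma>\<close>,
      extended by the identity because \<open>permutes\<close> demands fixed points outside
      \<open>{1..m}\<close>.\<close>
    define \<sigma> where "\<sigma> i = (if i \<in> {1..m} then inv_into {1..m} \<beta> (\<gamma> i) else i)" for i
    have "bij_betw (inv_into {1..m} \<beta> \<circ> \<gamma>) {1..m} {1..m}"
      using \<gamma> bij_betw_inv_into[OF \<beta>] by (rule bij_betw_trans)
    then have "bij_betw \<sigma> {1..m} {1..m}"
      by (rule bij_betw_cong[THEN iffD1, rotated]) (auto simp: \<sigma>_def)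
    then have "\<sigma> permutes {1..m}"
      by (rule bij_imp_permutes) (unfold \<sigma>_def, rule if_not_P)
    moreover have "Fs = adjunction_chain L K (\<beta> \<circ> \<sigma>) m" unfolding Fs
    proof (rule adjunction_chain_cong)
      fix i assume i: "i \<in> {1..m}"
      then have "\<gamma> i \<in> B" using \<gamma> by (auto simp: bij_betw_def)
      then show "\<gamma> i = (\<beta> \<circ> \<sigma>) i"
        using i bij_betw_inv_into_right[OF \<beta>] by (simp add: \<sigma>_def)
    qed
    ultimately show "Fs \<in> (\<lambda>\<sigma>. adjunction_chain L K (\<beta> \<circ> \<sigma>) m) ` {\<sigma>. \<sigma> permutes {1..m}}"
      by blast
  qed
  show "(\<lambda>\<sigma>. adjunction_chain L K (\<beta> \<circ> \<sigma>) m) ` {\<sigma>. \<sigma> permutes {1..m}}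
    \<subseteq> minimal_cluster_towers L K f B"
    unfolding minimal_cluster_towers_def m
    using assms(1) bij_betw_trans[OF permutes_imp_bij \<beta>] by blast
qed

section \<open>Minimal generating sets from towers\<close>

text \<open>Induction along the chain: a root that is not new lies in the field of its predecessors,
  which the new roots already generate.\<close>

lemma adjunction_chain_new_roots_generate:
  assumes \<gamma>: "\<gamma> ` {1..n} \<subseteq> carrier L"
    and N: "N = {j. j < n \<and> \<gamma> (Suc j) \<notin> adjoin L K (\<gamma> ` {1..j})}"
  shows "\<gamma> ` {1..n} \<subseteq> adjoin L K ((\<lambda>j. \<gamma> (Suc j)) ` N)"
proof -
  let ?A = "(\<lambda>j. \<gamma> (Suc j)) ` N"
  have A: "?A \<subseteq> carrier L" using \<gamma> N by auto
  have "\<gamma> ` {1..j} \<subseteq> adjoin L K ?A" if "j \<le> n" for j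
    using that
  proof (induction j)
    case (Suc j)
    then have IH: "\<gamma> ` {1..j} \<subseteq> adjoin L K ?A" by simp
    have "\<gamma> (Suc j) \<in> adjoin L K ?A"
    proof (cases "j \<in> N")
      case True then show ?thesis using adjoin_incl[of ?A] by blast
    next
      case False
      then have "\<gamma> (Suc j) \<in> adjoin L K (\<gamma> ` {1..j})" using Suc.prems N by auto
      then show ?thesis using adjoin_least[OF A IH] by blast
    qed
    with IH show ?case by (simp add: atLeastAtMostSuc_conv)
  qed simp
  then show ?thesis by blast
qed

text \<open>Bounds tower lengths from below by sizes of minimal generating sets.\<close>

lemma cluster_tower_minimal_generating_set:
  assumes "cluster_tower L K f Fs"
  obtains A where "minimal_generating_set L K f A" "card A \<le> tower_length Fs"
proof -
  obtain \<gamma> n where R: "\<gamma> ` {1..n} \<subseteq> root_set L f"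
    and Fs: "Fs = adjunction_chain L K \<gamma> n" "last Fs = splitting_field L K f"
    using assms unfolding cluster_tower_def by blast
  define N where "N = {j. j < n \<and> \<gamma> (Suc j) \<notin> adjoin L K (\<gamma> ` {1..j})}"
  let ?A = "(\<lambda>j. \<gamma> (Suc j)) ` N"
  have \<gamma>: "\<gamma> ` {1..n} \<subseteq> carrier L" using R root_set_in_carrier by blast
  have A: "?A \<subseteq> \<gamma> ` {1..n}" by (auto simp: N_def)
  have fin: "finite N" by (simp add: N_def)
  have "adjoin L K (\<gamma> ` {1..n}) = splitting_field L K f"
    using Fs last_adjunction_chain by simp
  then have gen: "adjoin L K ?A = splitting_field L K f"
    using adjoin_eq_splitting_fieldI[OF subset_trans[OF A R]]
      adjunction_chain_new_roots_generate[OF \<gamma> N_def] by blast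
  obtain A' where A': "A' \<subseteq> ?A" "minimal_generating_set L K f A'"
    using exists_minimal_generating_subset[OF finite_imageI[OF fin] subset_trans[OF A R] gen] .
  have "card A' \<le> card ?A" using A'(1) fin by (intro card_mono) auto
  also have "\<dots> \<le> card N" using fin by (rule card_image_le)
  also have "\<dots> = tower_length Fs"
    using tower_length_adjunction_chain[OF \<gamma>] Fs(1) by (simp add: N_def)
  finally show thesis using that A'(2) by blast
qed

text \<open>Any \<open>b\<close> can be moved to the last place by a transposition. The last step of
  that chain is new, so \<open>b\<close> is not in the field of the other roots.\<close>

lemma minimal_generating_setI_towers:
  assumes \<beta>: "inj_on \<beta> {1..m}" "\<beta> ` {1..m} \<subseteq> root_set L f"
    and towers: "\<And>\<sigma>. \<sigma> permutes {1..m} \<Longrightarrow>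
      cluster_tower L K f (adjunction_chain L K (\<beta> \<circ> \<sigma>) m) \<and>
      tower_length (adjunction_chain L K (\<beta> \<circ> \<sigma>) m) = m"
  shows "minimal_generating_set L K f (\<beta> ` {1..m})"
proof (rule minimal_generating_setI[OF \<beta>(2)])
  show "adjoin L K (\<beta> ` {1..m}) = splitting_field L K f"
    \<comment> \<open>One ordering is enough for generation; the identity permutation supplies
      it.\<close>
    using towers[OF permutes_id] last_adjunction_chain[of \<beta> m]
    by (auto simp: cluster_tower_def)
next
  fix b assume "b \<in> \<beta> ` {1..m}"
  then obtain i where i: "i \<in> {1..m}" and b: "b = \<beta> i" by blast
  then obtain k where k: "m = Suc k" by (cases m) auto
  let ?\<sigma> = "transpose i m"
  have \<sigma>: "?\<sigma> permutes {1..m}" using i by (intro permutes_swap_id) auto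
  have im: "(\<beta> \<circ> ?\<sigma>) ` {1..m} = \<beta> ` {1..m}"
    by (simp only: image_comp[symmetric] permutes_image[OF \<sigma>])
  have inj: "inj_on (\<beta> \<circ> ?\<sigma>) {1..m}"
    using comp_inj_on[OF permutes_inj_on[OF \<sigma>, of "{1..m}"]] \<beta>(1) permutes_image[OF \<sigma>] by metis
  have last: "(\<beta> \<circ> ?\<sigma>) m = b" by (simp add: b)
  \<comment> \<open>Since \<open>m = Suc k\<close>, the first \<open>k\<close> roots are all but the
    last; injectivity turns this into removal of \<open>b\<close>.\<close>
  have "(\<beta> \<circ> ?\<sigma>) ` {1..k} = (\<beta> \<circ> ?\<sigma>) ` ({1..m} - {m})"
    by (rule arg_cong[of _ _ "image _"]) (auto simp: k)
  also have "\<dots> = \<beta> ` {1..m} - {b}"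
    using inj_on_image_set_diff[OF inj, of "{1..m}" "{m}"] im last i by auto
  finally have init: "(\<beta> \<circ> ?\<sigma>) ` {1..k} = \<beta> ` {1..m} - {b}" .
  have "(\<beta> \<circ> ?\<sigma>) ` {1..m} \<subseteq> carrier L" using im \<beta>(2) root_set_in_carrier by auto
  from tower_length_eq_iff[OF this] towers[OF \<sigma>]
  have "(\<beta> \<circ> ?\<sigma>) (Suc k) \<notin> adjoin L K ((\<beta> \<circ> ?\<sigma>) ` {1..k})" using k by blast
  then show "b \<notin> adjoin L K (\<beta> ` {1..m} - {b})" using init last k by metis
qed

lemma tower_length_minimal_generating_set:
  assumes "finite A" "minimal_generating_set L K f A"
  obtains Fs where "cluster_tower L K f Fs" "tower_length Fs = card A"
proof -
  obtain \<gamma> where "bij_betw \<gamma> {1..card A} A"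
    using ex_bij_betw_nat_finite_1[OF assms(1)] by blast
  with minimal_generating_set_tower[OF assms(2)] that show thesis by blast
qed

text \<open>Sizes of minimal generating sets occur as tower lengths, and every tower length is at
  least such a size, so both have the same minimum.\<close>

lemma shortest_minimal_generating_set_iff:
  assumes f: "f \<in> carrier (K[X])" and \<beta>: "bij_betw \<beta> {1..m} B" and R: "B \<subseteq> root_set L f"
  shows "shortest_minimal_generating_set L K f B \<longleftrightarrow>
    cluster_tower L K f (adjunction_chain L K \<beta> m) \<and>
    tower_length (adjunction_chain L K \<beta> m) = m \<and>
    (\<forall>Fs. cluster_tower L K f Fs \<longrightarrow> m \<le> tower_length Fs)" (is "?S \<longleftrightarrow> ?T")
proof
  have m: "card B = m" and im: "\<beta> ` {1..m} = B"
    using bij_betw_same_card[OF \<beta>] \<beta> by (auto simp: bij_betw_def)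
  show ?T if ?S
  proof -
    from that have B: "minimal_generating_set L K f B"
      and short: "\<And>A. minimal_generating_set L K f A \<Longrightarrow> m \<le> card A"
      by (auto simp: shortest_minimal_generating_set_def m)
    have "m \<le> tower_length Fs" if "cluster_tower L K f Fs" for Fs
      using cluster_tower_minimal_generating_set[OF that] short le_trans by metis
    with minimal_generating_set_tower[OF B \<beta>] show ?T by blast
  qed
  show ?S if ?T
  proof -
    from that have least: "\<And>Fs. cluster_tower L K f Fs \<Longrightarrow> m \<le> tower_length Fs"
      and gen: "adjoin L K B = splitting_field L K f"
      using last_adjunction_chain[of \<beta> m] im by (auto simp: cluster_tower_def)
    have short: "m \<le> card A" if A: "minimal_generating_set L K f A" for A
    proof -
      \<comment> \<open>needed because \<^const>\<open>card\<close> is \<open>0\<close> on infinite sets\<close>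
      have "finite A"
        using A finite_root_set[OF f] finite_subset unfolding minimal_generating_set_def by blast
      then show ?thesis using tower_length_minimal_generating_set[OF _ A] least by metis
    qed
    have fin: "finite B" using R finite_root_set[OF f] finite_subset by blast
    obtain A where A: "A \<subseteq> B" "minimal_generating_set L K f A"
      using exists_minimal_generating_subset[OF fin R gen] .
    \<comment> \<open>Minimality of \<open>B\<close> comes from counting: the minimal generating
      subset \<open>A\<close> has at least \<open>m\<close> elements, which is the size of
      \<open>B\<close>.\<close>
    have "A = B" using A short[of A] m fin by (intro card_seteq) auto
    with A short show ?S by (auto simp: shortest_minimal_generating_set_def m)
  qed
qed

end

theorem proposition2p8:
  fixes L :: "('a, 'b) ring_scheme" and K :: "'a set" and f :: "'a list"
    and \<beta> :: "nat \<Rightarrow> 'a" and m :: nat and B :: "'a set"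
  assumes "algebraic_closure L K"
    and "perfect_subfield L K"
    and "f \<in> carrier (univ_poly L K)"
    and "pirreducible\<^bsub>L\<^esub> K f"
    and "inj_on \<beta> {1..m}"
    and "B = \<beta> ` {1..m}"
    and "B \<subseteq> root_set L f"
  shows
    "(minimal_generating_set L K f B \<longleftrightarrow>
        (\<forall>\<sigma>. \<sigma> permutes {1..m} \<longrightarrow>
           cluster_tower L K f (adjunction_chain L K (\<beta> \<circ> \<sigma>) m) \<and>
           tower_length (adjunction_chain L K (\<beta> \<circ> \<sigma>) m) = m))
     \<and>
     (minimal_generating_set L K f B \<longrightarrow>
        (\<forall>\<sigma> \<tau>. \<sigma> permutes {1..m} \<longrightarrow> \<tau> permutes {1..m} \<longrightarrow> \<sigma> \<noteq> \<tau> \<longrightarrow>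
           adjunction_chain L K (\<beta> \<circ> \<sigma>) m \<noteq> adjunction_chain L K (\<beta> \<circ> \<tau>) m) \<and>
        card (minimal_cluster_towers L K f B) = fact m)
     \<and>
     (shortest_minimal_generating_set L K f B \<longleftrightarrow>
        cluster_tower L K f (adjunction_chain L K \<beta> m) \<and>
        tower_length (adjunction_chain L K \<beta> m) = m \<and>
        (\<forall>Fs. cluster_tower L K f Fs \<longrightarrow> m \<le> tower_length Fs))"
proof (intro conjI impI)
  interpret algebraic_closure L K by fact
  have \<beta>: "bij_betw \<beta> {1..m} B" using assms(5,6) by (simp add: bij_betw_def)
  have \<beta>\<sigma>: "bij_betw (\<beta> \<circ> \<sigma>) {1..m} B" if "\<sigma> permutes {1..m}" for \<sigma>
    using bij_betw_trans[OF permutes_imp_bij[OF that] \<beta>] .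
  show "minimal_generating_set L K f B \<longleftrightarrow>
        (\<forall>\<sigma>. \<sigma> permutes {1..m} \<longrightarrow>
           cluster_tower L K f (adjunction_chain L K (\<beta> \<circ> \<sigma>) m) \<and>
           tower_length (adjunction_chain L K (\<beta> \<circ> \<sigma>) m) = m)"
    using minimal_generating_set_tower[OF _ \<beta>\<sigma>] minimal_generating_setI_towers assms(5-7) by metis
  show "shortest_minimal_generating_set L K f B \<longleftrightarrow>
        cluster_tower L K f (adjunction_chain L K \<beta> m) \<and>
        tower_length (adjunction_chain L K \<beta> m) = m \<and>
        (\<forall>Fs. cluster_tower L K f Fs \<longrightarrow> m \<le> tower_length Fs)"
    using shortest_minimal_generating_set_iff[OF assms(3) \<beta> assms(7)] .
  assume B: "minimal_generating_set L K f B"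
  have eq: "\<sigma> = \<tau>" if \<sigma>: "\<sigma> permutes {1..m}" and \<tau>: "\<tau> permutes {1..m}"
    and chains: "adjunction_chain L K (\<beta> \<circ> \<sigma>) m = adjunction_chain L K (\<beta> \<circ> \<tau>) m" for \<sigma> \<tau>
  proof
    fix i
    show "\<sigma> i = \<tau> i"
    \<comment> \<open>Equality is needed on all of \<open>nat\<close>: inside \<open>{1..m}\<close>
      the chains decide and \<open>\<beta>\<close> is cancelled, outside both permutations fix
      \<open>i\<close>.\<close>
    proof (cases "i \<in> {1..m}")
      case True
      then have "\<beta> (\<sigma> i) = \<beta> (\<tau> i)"
        using adjunction_chain_inj[OF B \<beta>\<sigma>[OF \<sigma>] \<beta>\<sigma>[OF \<tau>] chains] by simp
      moreover have "\<sigma> i \<in> {1..m}" "\<tau> i \<in> {1..m}"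
        using True permutes_in_image[OF \<sigma>] permutes_in_image[OF \<tau>] by blast+
      ultimately show ?thesis using assms(5) inj_onD by metis
    next
      case False
      then show ?thesis using permutes_not_in[OF \<sigma>] permutes_not_in[OF \<tau>] by metis
    qed
  qed
  then show "\<forall>\<sigma> \<tau>. \<sigma> permutes {1..m} \<longrightarrow> \<tau> permutes {1..m} \<longrightarrow> \<sigma> \<noteq> \<tau> \<longrightarrow>
           adjunction_chain L K (\<beta> \<circ> \<sigma>) m \<noteq> adjunction_chain L K (\<beta> \<circ> \<tau>) m"
    by blast
  have "inj_on (\<lambda>\<sigma>. adjunction_chain L K (\<beta> \<circ> \<sigma>) m) {\<sigma>. \<sigma> permutes {1..m}}"
    using eq by (auto intro: inj_onI)
  then show "card (minimal_cluster_towers L K f B) = fact m"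
    unfolding minimal_cluster_towers_eq[OF B \<beta>]
    by (simp add: card_image card_permutations)
qed

end
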